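(* Let $\mathcal{T}=(t_{ijkl})\in\widehat{\mathcal{E}}_{4,3}$ and let $(i,j,k)$ be a permutation of $(1,2,3)$ such that $$-t_{iiij}t_{ijjj}=-t_{jjjk}t_{jkkk}=t_{iiik}t_{ikkk}=1.$$ Then $\mathcal{T}$ is positive semi-definite if and only if $$t_{iijk}t_{jkkk}=t_{ijkk}t_{iiij}=t_{iiik}t_{jkkk}t_{iiij}=t_{1122}=t_{2233}=t_{1133}=1\quad\text{and}\quad t_{ijjk}t_{iiik}\in\{0,1\}.$$
   Context: A 4th order 3-dimensional real tensor $\mathcal{T}=(t_{ijkl})_{i,j,k,l\in\{1,2,3\}}$ is symmetric if its entries are invariant under all permutations of the four indices (so, e.g., $t_{ijjk}$ denotes the common value of all entries whose index multiset is $\{i,j,j,k\}$). $\widehat{\mathcal{E}}_{4,3}$ is the set of symmetric 4th order 3-dimensional tensors all of whose entries lie in $\{-1,0,1\}$ and whose diagonal entries satisfy $t_{1111}=t_{2222}=t_{3333}=1$. For $x\in\mathbb{R}^3$ put $\mathcal{T}x^4=\sum_{i,j,k,l=1}^3 t_{ijkl}x_ix_jx_kx_l$. $\mathcal{T}$ is positive semi-definite if $\mathcal{T}x^4\ge 0$ for all $x\in\mathbb{R}^3$. *)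

theory Defs
  imports "HOL-Analysis.Analysis" "HOL-Library.Multiset"
begin

text \<open>
  A 4th order 3-dimensional real tensor is an element \<open>T\<close> of the type below, with entries
  \<open>T $ i $ j $ k $ l\<close>. The index type \<open>3\<close> has exactly the three elements \<open>1\<close>, \<open>2\<close>, \<open>3\<close>,
  where the numeral \<open>3\<close> denotes the same element as \<open>0\<close>.
\<close>

type_synonym tensor43 = "real ^ 3 ^ 3 ^ 3 ^ 3"

text \<open>Two index lists are permutations of each other iff their multisets agree.\<close>

definition symmetric_tensor :: "tensor43 \<Rightarrow> bool" where
  "symmetric_tensor T \<longleftrightarrow>
     (\<forall>i j k l i' j' k' l'. mset [i, j, k, l] = mset [i', j', k', l'] \<longrightarrow>
        T $ i $ j $ k $ l = T $ i' $ j' $ k' $ l')"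

definition E_hat :: "tensor43 set" where
  "E_hat = {T. symmetric_tensor T \<and>
              (\<forall>i j k l. T $ i $ j $ k $ l \<in> {-1, 0, 1}) \<and>
              T $ 1 $ 1 $ 1 $ 1 = 1 \<and> T $ 2 $ 2 $ 2 $ 2 = 1 \<and> T $ 3 $ 3 $ 3 $ 3 = 1}"

definition quartic_form :: "tensor43 \<Rightarrow> real ^ 3 \<Rightarrow> real" where
  "quartic_form T x =
     (\<Sum>i\<in>UNIV. \<Sum>j\<in>UNIV. \<Sum>k\<in>UNIV. \<Sum>l\<in>UNIV.
        T $ i $ j $ k $ l * x $ i * x $ j * x $ k * x $ l)"

definition positive_semidefinite :: "tensor43 \<Rightarrow> bool" where
  "positive_semidefinite T \<longleftrightarrow> (\<forall>x. quartic_form T x \<ge> 0)"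

end

theory Submission
  imports Defs
begin

text \<open>
  Write \<open>x, y, z\<close> for the coordinates with indices \<open>i, j, k\<close>. Changing the signs of \<open>x\<close> and \<open>z\<close>
  reduces to \<open>t\<^sub>i\<^sub>i\<^sub>i\<^sub>j = t\<^sub>j\<^sub>k\<^sub>k\<^sub>k = 1\<close>. In that normal form, and with the
  remaining conditions satisfied, put \<open>s = x + z\<close>: the form depends only on \<open>s\<close>, \<open>y\<close> and \<open>x z\<close>, and it is
  a sum of squares in \<open>s, y\<close> when \<open>t\<^sub>i\<^sub>j\<^sub>j\<^sub>k = 1\<close>; when \<open>t\<^sub>i\<^sub>j\<^sub>j\<^sub>k = 0\<close> it
  suffices to bound \<open>x z \<le> s\<^sup>2 / 4\<close>. Conversely, each violated condition is refuted by
  evaluating the form at a point: near a zero of the restriction of the form to a coordinate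
  plane, or where \<open>x z\<close> is very negative compared with \<open>s\<close>.
\<close>

definition normal_form ::
    "real \<Rightarrow> real \<Rightarrow> real \<Rightarrow> real \<Rightarrow> real \<Rightarrow> real \<Rightarrow> real \<Rightarrow> real \<Rightarrow> real \<Rightarrow> real \<Rightarrow> real" where
  "normal_form c d e f g h m x y z =
     x^4 + y^4 + z^4 + 4 * (x^3 * y - x * y^3) + 4 * (y * z^3 - y^3 * z) + 4 * c * (x^3 * z + x * z^3)
     + 6 * (d * x^2 * y^2 + e * y^2 * z^2 + f * x^2 * z^2)
     + 12 * (g * x^2 * y * z + h * x * y^2 * z + m * x * y * z^2)"

lemma normal_form_nonneg:
  assumes "h \<in> {0, 1}"
  shows "normal_form 1 1 1 1 1 h 1 x y z \<ge> 0"
proof -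
  define s where "s = x + z"
  have "normal_form 1 1 1 1 1 1 1 x y z = (s^2 + 2 * s * y - y^2)^2 + 4 * s^2 * y^2"
    unfolding normal_form_def s_def by algebra
  \<comment> \<open>Dropping \<open>h\<close> from 1 to 0 subtracts
    \<open>12 * x * y^2 * z = 3 * (s^2 - (x - z)^2) * y^2\<close>.\<close>
  moreover have "normal_form 1 1 1 1 1 0 1 x y z
      = (s^2 + 2 * s * y - y^2)^2 + s^2 * y^2 + 3 * (x - z)^2 * y^2"
    unfolding normal_form_def s_def by algebra
  ultimately show ?thesis
    using assms by auto
qed

lemma normal_form_nonneg_imp:
  assumes nonneg: "\<And>x y z. normal_form c d e f g h m x y z \<ge> 0"
    and c: "c \<in> {-1, 1}"
    and "d \<in> {-1, 0, 1}" "e \<in> {-1, 0, 1}" "f \<in> {-1, 0, 1}"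
    and g: "g \<in> {-1, 0, 1}" and h: "h \<in> {-1, 0, 1}" and m: "m \<in> {-1, 0, 1}"
  shows "c = 1 \<and> d = 1 \<and> e = 1 \<and> f = 1 \<and> g = 1 \<and> m = 1 \<and> h \<in> {0, 1}"
proof -
  \<comment> \<open>For \<open>z = 0\<close> the form is
    \<open>(x^2 + 2*x*y - y^2)^2 + (6*d - 2) * x^2 * y^2\<close>, and 5/2 approximates the root 1 +
    sqrt 2 of the square. Exchanging \<open>x\<close> and \<open>z\<close> treats
    \<open>e\<close>.\<close>
  have d: "d = 1"
    using nonneg[of 2 5 0] assms(3) by (auto simp: normal_form_def)
  have e: "e = 1"
    using nonneg[of 0 5 2] assms(4) by (auto simp: normal_form_def)
  \<comment> \<open>For \<open>y = 0\<close> the form is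
    \<open>(x + c*z)^4 + 6 * (f - 1) * x^2 * z^2\<close>.\<close>
  have f: "f = 1"
    using nonneg[of 1 0 "-c"] c assms(5) by (auto simp: normal_form_def)
  \<comment> \<open>\<open>(1, 0, 1)\<close> (if \<open>c = -1\<close>) and \<open>(1, 0, -1)\<close> (if \<open>c = 1\<close>) are zeros, so the derivative in
    direction \<open>y\<close> must vanish there.\<close>
  have c1: "c = 1"
    using nonneg[of 1 "1/10" 1] nonneg[of 1 "-1/10" 1] c g h m d e f
    by (auto simp: normal_form_def power_divide)
  have gm: "g = m"
    using nonneg[of 1 "1/10" "-1"] nonneg[of 1 "-1/10" "-1"] g h m d e f c1
    by (auto simp: normal_form_def power_divide)
  \<comment> \<open>With \<open>g = m\<close> and \<open>s = x + z\<close>, the terms in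
    \<open>x * z\<close> are \<open>12*x*z*y * ((g - 1)*s + (h - 1)*y)\<close>. Here
    \<open>s = -3\<close> and \<open>x * z = -4\<close>, so for \<open>g \<le> 0\<close> they
    contribute at most -48 against 40 from the rest.\<close>
  have g1: "g = 1"
    using nonneg[of 1 1 "-4"] g h d e f c1 gm by (auto simp: normal_form_def)
  \<comment> \<open>On \<open>x = z\<close> the form is
    \<open>(s^2 + 2*s*y - y^2)^2 + (1 + 3*h) * s^2 * y^2\<close> with \<open>s = 2 * x\<close>;
    again \<open>y / s = 5/2\<close>.\<close>
  have "h \<in> {0, 1}"
    using nonneg[of 1 5 1] h d e f c1 gm g1 by (auto simp: normal_form_def)
  then show ?thesis
    using c1 d e f gm g1 by simp
qed

lemma UNIV_distinct_index_3:
  fixes i j k :: 3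
  assumes "distinct [i, j, k]"
  shows "UNIV = {i, j, k}"
proof -
  have "card {i, j, k} = CARD(3)"
    using assms by simp
  then show ?thesis
    by (metis card_subset_eq finite_class.finite_UNIV subset_UNIV)
qed

lemma sum_distinct_index_3:
  fixes i j k :: 3
  assumes "distinct [i, j, k]"
  shows "sum F UNIV = F i + F j + F k"
  unfolding UNIV_distinct_index_3[OF assms] using assms by (simp add: add.assoc)

lemma symmetric_tensorD:
  assumes "symmetric_tensor T" and "mset [i, j, k, l] = mset [i', j', k', l']"
  shows "T $ i $ j $ k $ l = T $ i' $ j' $ k' $ l'"
  using assms unfolding symmetric_tensor_def by blast

text \<open>Adjacent transpositions generate all permutations; used as permutative rewrite rules,
  they sort the indices of every entry.\<close>

lemma symmetric_tensor_swap:
  assumes "symmetric_tensor T"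
  shows "T $ a $ b $ c $ d = T $ b $ a $ c $ d"
    and "T $ a $ b $ c $ d = T $ a $ c $ b $ d"
    and "T $ a $ b $ c $ d = T $ a $ b $ d $ c"
  by (rule symmetric_tensorD[OF assms], simp add: add_mset_commute)+

text \<open>The right-hand side does not mention \<open>i, j, k\<close>, so conditions on these
  indices can be traded for conditions on 1, 2, 3.\<close>

lemma symmetric_tensor_mixed_squares:
  fixes i j k :: 3
  assumes "symmetric_tensor T" and "distinct [i, j, k]"
  shows "T $ i $ i $ j $ j = 1 \<and> T $ j $ j $ k $ k = 1 \<and> T $ i $ i $ k $ k = 1
    \<longleftrightarrow> (\<forall>p q. p \<noteq> q \<longrightarrow> T $ p $ p $ q $ q = 1)"
proof -
  have swap: "T $ p $ p $ q $ q = T $ q $ q $ p $ p" for p q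
    by (rule symmetric_tensorD[OF assms(1)]) (simp add: add_mset_commute)
  have "p \<in> {i, j, k}" for p
    using UNIV_distinct_index_3[OF assms(2)] by blast
  then show ?thesis
    using assms(2) swap by (smt (verit) distinct_length_2_or_more insertE singletonD)
qed

lemma quartic_form_expand:
  fixes i j k :: 3
  assumes "symmetric_tensor T" and "distinct [i, j, k]"
  shows "quartic_form T v =
     T $ i $ i $ i $ i * (v $ i)^4 + T $ j $ j $ j $ j * (v $ j)^4 + T $ k $ k $ k $ k * (v $ k)^4
     + 4 * (T $ i $ i $ i $ j * (v $ i)^3 * v $ j + T $ i $ j $ j $ j * v $ i * (v $ j)^3)
     + 4 * (T $ j $ j $ j $ k * (v $ j)^3 * v $ k + T $ j $ k $ k $ k * v $ j * (v $ k)^3)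
     + 4 * (T $ i $ i $ i $ k * (v $ i)^3 * v $ k + T $ i $ k $ k $ k * v $ i * (v $ k)^3)
     + 6 * (T $ i $ i $ j $ j * (v $ i)^2 * (v $ j)^2 + T $ j $ j $ k $ k * (v $ j)^2 * (v $ k)^2
          + T $ i $ i $ k $ k * (v $ i)^2 * (v $ k)^2)
     + 12 * (T $ i $ i $ j $ k * (v $ i)^2 * v $ j * v $ k
          + T $ i $ j $ j $ k * v $ i * (v $ j)^2 * v $ k
          + T $ i $ j $ k $ k * v $ i * v $ j * (v $ k)^2)"
proof -
  note swap = symmetric_tensor_swap[OF assms(1)]
  show ?thesis
    unfolding quartic_form_def sum_distinct_index_3[OF assms(2)]
    by (simp only: swap) algebra
qed

theorem theorem3p3:
  fixes T :: "real ^ 3 ^ 3 ^ 3 ^ 3" and i j k :: 3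
  assumes "T \<in> E_hat"
    and "mset [i, j, k] = mset [1, 2, 3]"
    and "- (T $ i $ i $ i $ j * T $ i $ j $ j $ j) = 1"
    and "- (T $ j $ j $ j $ k * T $ j $ k $ k $ k) = 1"
    and "T $ i $ i $ i $ k * T $ i $ k $ k $ k = 1"
  shows "positive_semidefinite T \<longleftrightarrow>
      T $ i $ i $ j $ k * T $ j $ k $ k $ k = 1 \<and>
      T $ i $ j $ k $ k * T $ i $ i $ i $ j = 1 \<and>
      T $ i $ i $ i $ k * T $ j $ k $ k $ k * T $ i $ i $ i $ j = 1 \<and>
      T $ 1 $ 1 $ 2 $ 2 = 1 \<and> T $ 2 $ 2 $ 3 $ 3 = 1 \<and> T $ 1 $ 1 $ 3 $ 3 = 1 \<and>
      T $ i $ j $ j $ k * T $ i $ i $ i $ k \<in> {0, 1}"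
proof -
  define a b c where abc: "a = T $ i $ i $ i $ j" "b = T $ j $ k $ k $ k" "c = T $ i $ i $ i $ k"
  define d e f where def: "d = T $ i $ i $ j $ j" "e = T $ j $ j $ k $ k" "f = T $ i $ i $ k $ k"
  define g h m where ghm: "g = T $ i $ i $ j $ k" "h = T $ i $ j $ j $ k" "m = T $ i $ j $ k $ k"
  have sym: "symmetric_tensor T" and entries: "\<And>p q r s. T $ p $ q $ r $ s \<in> {-1, 0, 1}"
    using assms(1) by (auto simp: E_hat_def)
  have diag: "T $ p $ p $ p $ p = 1" for p
    using assms(1) exhaust_3[of p] by (auto simp: E_hat_def)
  have "distinct [i, j, k]"
    using mset_eq_imp_distinct_iff[OF assms(2)] by simp
  have squares: "(T $ 1 $ 1 $ 2 $ 2 = 1 \<and> T $ 2 $ 2 $ 3 $ 3 = 1 \<and> T $ 1 $ 1 $ 3 $ 3 = 1)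
      \<longleftrightarrow> d = 1 \<and> e = 1 \<and> f = 1"
    unfolding def
    using symmetric_tensor_mixed_squares[OF sym, of 1 2 3]
      symmetric_tensor_mixed_squares[OF sym \<open>distinct [i, j, k]\<close>] by simp
  have a: "a \<in> {-1, 1}" "T $ i $ j $ j $ j = - a"
    using assms(3) entries[of i i i j] entries[of i j j j] by (auto simp: abc)
  have b: "b \<in> {-1, 1}" "T $ j $ j $ j $ k = - b"
    using assms(4) entries[of j j j k] entries[of j k k k] by (auto simp: abc)
  have c: "c \<in> {-1, 1}" "T $ i $ k $ k $ k = c"
    using assms(5) entries[of i i i k] entries[of i k k k] by (auto simp: abc)
  have form: "quartic_form T v
      = normal_form (c * b * a) d e f (g * b) (h * (a * b)) (m * a)
          (a * v $ i) (v $ j) (b * v $ k)" for v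
    using a(1) b(1)
    by (auto simp: quartic_form_expand[OF sym \<open>distinct [i, j, k]\<close>] diag a(2) b(2) c(2)
        abc[symmetric] def[symmetric] ghm[symmetric] normal_form_def algebra_simps)
  have "positive_semidefinite T
      \<longleftrightarrow> (\<forall>x y z. normal_form (c * b * a) d e f (g * b) (h * (a * b)) (m * a) x y z \<ge> 0)"
  proof
    assume psd: "positive_semidefinite T"
    show "\<forall>x y z. normal_form (c * b * a) d e f (g * b) (h * (a * b)) (m * a) x y z \<ge> 0"
    proof (intro allI)
      fix x y z
      \<comment> \<open>\<open>a\<close> and \<open>b\<close> are signs, hence their own
        inverses.\<close>
      define v :: "real ^ 3" where "v = (\<chi> l. if l = i then a * x else if l = j then y else b * z)"
      have "a * v $ i = x" "v $ j = y" "b * v $ k = z"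
        using a(1) b(1) \<open>distinct [i, j, k]\<close> by (auto simp: v_def)
      then show "normal_form (c * b * a) d e f (g * b) (h * (a * b)) (m * a) x y z \<ge> 0"
        using psd form[of v] unfolding positive_semidefinite_def by metis
    qed
  qed (simp add: positive_semidefinite_def form)
  also have "\<dots> \<longleftrightarrow> c * b * a = 1 \<and> d = 1 \<and> e = 1 \<and> f = 1
      \<and> g * b = 1 \<and> m * a = 1 \<and> h * (a * b) \<in> {0, 1}"
  proof
    assume "\<forall>x y z. normal_form (c * b * a) d e f (g * b) (h * (a * b)) (m * a) x y z \<ge> 0"
    moreover have "c * b * a \<in> {-1, 1}"
      using a(1) b(1) c(1) by auto
    moreover have "g * b \<in> {-1, 0, 1}"
      using b(1) entries[of i i j k] unfolding ghm by auto
    moreover have "h * (a * b) \<in> {-1, 0, 1}"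
      using a(1) b(1) entries[of i j j k] unfolding ghm by auto
    moreover have "m * a \<in> {-1, 0, 1}"
      using a(1) entries[of i j k k] unfolding ghm by auto
    moreover have "d \<in> {-1, 0, 1}" "e \<in> {-1, 0, 1}" "f \<in> {-1, 0, 1}"
      unfolding def by (rule entries)+
    ultimately show "c * b * a = 1 \<and> d = 1 \<and> e = 1 \<and> f = 1 \<and> g * b = 1 \<and> m * a = 1
        \<and> h * (a * b) \<in> {0, 1}"
      by (intro normal_form_nonneg_imp) blast+
  qed (use normal_form_nonneg in auto)
  \<comment> \<open>For signs, \<open>c * b * a = 1\<close> means \<open>a * b = c\<close>.\<close>
  also have "\<dots> \<longleftrightarrow> g * b = 1 \<and> m * a = 1 \<and> c * b * a = 1 \<and> d = 1 \<and> e = 1 \<and> f = 1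
      \<and> h * c \<in> {0, 1}"
    using a(1) b(1) c(1) by auto
  finally show ?thesis
    using squares unfolding abc ghm by blast
qed

end
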